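(* Let $G$ be a graph with $m$ edges and let $\vartheta=\vartheta(\bar G)$ be the Lovász theta function of the complement $\bar G$ of $G$. Then $$\mathrm{sp}(G)\geq \frac{1}{\pi}\cdot\frac{m}{\vartheta-1}.$$
   Context: All graphs are finite and simple. For a graph $G$, $\mathrm{mc}(G)$ is the maximum number of edges of a bipartite subgraph of $G$ and $\mathrm{sp}(G)=\mathrm{mc}(G)-e(G)/2$, where $e(G)$ is the number of edges. The Lovász theta function $\vartheta(F)$ of a graph $F$ is the minimal real $\kappa\geq 2$ for which there exists a unit vector $\mathbf{x}_v$ in some Euclidean space for each vertex $v$ of $F$ such that $\langle \mathbf{x}_u,\mathbf{x}_v\rangle=-\frac{1}{\kappa-1}$ whenever $u,v$ are distinct vertices of $F$ with $uv\notin E(F)$. Thus for $F=\bar G$, the condition is imposed on all pairs $uv\in E(G)$. *)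

theory Defs
  imports Complex_Main
begin

type_synonym 'a ugraph = "'a set \<times> 'a set set"

abbreviation verts :: "'a ugraph \<Rightarrow> 'a set" where
  "verts G \<equiv> fst G"

abbreviation edges :: "'a ugraph \<Rightarrow> 'a set set" where
  "edges G \<equiv> snd G"

definition finite_simple_graph :: "'a ugraph \<Rightarrow> bool" where
  "finite_simple_graph G \<longleftrightarrow>
     finite (verts G) \<and> (\<forall>e\<in>edges G. e \<subseteq> verts G \<and> card e = 2)"

definition complement_graph :: "'a ugraph \<Rightarrow> 'a ugraph" where
  "complement_graph G =
     (verts G, {{u, v} | u v. u \<in> verts G \<and> v \<in> verts G \<and> u \<noteq> v \<and> {u, v} \<notin> edges G})"

definition is_subgraph :: "'a ugraph \<Rightarrow> 'a ugraph \<Rightarrow> bool" where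
  "is_subgraph H G \<longleftrightarrow>
     finite_simple_graph H \<and> verts H \<subseteq> verts G \<and> edges H \<subseteq> edges G"

definition bipartite :: "'a ugraph \<Rightarrow> bool" where
  "bipartite H \<longleftrightarrow>
     (\<exists>A B. A \<union> B = verts H \<and> A \<inter> B = {} \<and> (\<forall>e\<in>edges H. \<exists>a\<in>A. \<exists>b\<in>B. e = {a, b}))"

definition mc :: "'a ugraph \<Rightarrow> nat" where
  "mc G = Max {card (edges H) | H. is_subgraph H G \<and> bipartite H}"

definition sp :: "'a ugraph \<Rightarrow> real" where
  "sp G = real (mc G) - real (card (edges G)) / 2"

text \<open>The dimension is existentially quantified below, so it cannot be a type: a vector of
  Euclidean \<open>d\<close>-space is a function on \<open>nat\<close> of which only the values below \<open>d\<close> matter.\<close>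

definition euclid_inner :: "nat \<Rightarrow> (nat \<Rightarrow> real) \<Rightarrow> (nat \<Rightarrow> real) \<Rightarrow> real" where
  "euclid_inner d x y = (\<Sum>i<d. x i * y i)"

definition theta_feasible :: "'a ugraph \<Rightarrow> real \<Rightarrow> bool" where
  "theta_feasible F \<kappa> \<longleftrightarrow> \<kappa> \<ge> 2 \<and>
     (\<exists>(d::nat) (x :: 'a \<Rightarrow> nat \<Rightarrow> real).
        (\<forall>v\<in>verts F. euclid_inner d (x v) (x v) = 1) \<and>
        (\<forall>u\<in>verts F. \<forall>v\<in>verts F. u \<noteq> v \<longrightarrow> {u, v} \<notin> edges F \<longrightarrow>
           euclid_inner d (x u) (x v) = - (1 / (\<kappa> - 1))))"

text \<open>For a finite graph the minimum exists: \<open>max 2 n\<close> is feasible for \<open>n\<close> vertices (take the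
  vertices of a regular simplex), and since \<open>n\<close> dimensions suffice, the set of feasible values
  is closed by compactness.\<close>

definition lovasz_theta :: "'a ugraph \<Rightarrow> real" where
  "lovasz_theta F = (LEAST \<kappa>. theta_feasible F \<kappa>)"

end

theory Submission
  imports Defs "HOL-Probability.Probability" "HOL-Real_Asymp.Real_Asymp"
begin

text \<open>Take unit vectors \<open>x v\<close> that realise \<open>\<theta>\<close>, so that \<open>\<langle>x u, x v\<rangle> = - t\<close> with \<open>t = 1 / (\<theta> - 1)\<close>
  on every edge, and project them on a random Gaussian vector \<open>g\<close>. Hyperplane rounding would use
  \<open>sgn \<langle>g, x v\<rangle>\<close>; here the sign is replaced by an odd trigonometric polynomial \<open>f\<close> with values in
  \<open>[-1, 1]\<close> and nonnegative sine coefficients, namely a rescaled Fejer mean of the square wave.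
  Since \<open>E cos \<langle>g, z\<rangle> = exp (- \<bar>z\<bar>\<^sup>2 / 2)\<close>, the expectation of \<open>sin (a \<langle>g, x u\<rangle>) sin (b \<langle>g, x v\<rangle>)\<close> is
  \<open>exp (- (a\<^sup>2 + b\<^sup>2) / 2) sinh (- a b t)\<close>, and \<open>sinh y \<le> y\<close> for \<open>y \<le> 0\<close> gives
  \<open>E f(\<langle>g, x u\<rangle>) f(\<langle>g, x v\<rangle>) \<le> - t A\<^sup>2\<close>, where the square of \<open>A\<close>
  (\<open>fejer_weight\<close>) comes arbitrarily close to \<open>2 / \<pi>\<close> by a Riemann sum
  for the Gaussian integral. As the edge sum is affine in each value, the values \<open>f \<langle>g, x v\<rangle>\<close> can be
  rounded to signs, which form a cut. That the minimum defining \<open>\<theta>\<close> is attained follows by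
  compactness of the Gram matrices, as positive semidefinite matrices are exactly the Gram matrices.\<close>

section \<open>Attainment of the theta function\<close>

definition psd_on :: "'a set \<Rightarrow> ('a \<Rightarrow> 'a \<Rightarrow> real) \<Rightarrow> bool" where
  "psd_on S K \<longleftrightarrow> (\<forall>u\<in>S. \<forall>v\<in>S. K u v = K v u) \<and>
     (\<forall>a. 0 \<le> (\<Sum>u\<in>S. \<Sum>v\<in>S. a u * a v * K u v))"

text \<open>The form is the squared norm of the combination of the vectors \<open>x u\<close> with
  coefficients \<open>a u\<close>.\<close>

lemma psd_on_Gram: "psd_on S (\<lambda>u v. euclid_inner d (x u) (x v))"
  unfolding psd_on_def
proof (intro conjI ballI allI)
  show "euclid_inner d (x u) (x v) = euclid_inner d (x v) (x u)" for u v
    by (simp add: euclid_inner_def mult.commute)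
next
  fix a :: "'a \<Rightarrow> real"
  have "(\<Sum>u\<in>S. \<Sum>v\<in>S. a u * a v * euclid_inner d (x u) (x v))
      = (\<Sum>u\<in>S. \<Sum>v\<in>S. \<Sum>i<d. (a u * x u i) * (a v * x v i))"
    by (simp add: euclid_inner_def sum_distrib_left mult_ac)
  also have "\<dots> = (\<Sum>u\<in>S. \<Sum>i<d. \<Sum>v\<in>S. (a u * x u i) * (a v * x v i))"
    by (intro sum.cong refl sum.swap)
  also have "\<dots> = (\<Sum>i<d. \<Sum>u\<in>S. \<Sum>v\<in>S. (a u * x u i) * (a v * x v i))"
    by (rule sum.swap)
  also have "\<dots> = (\<Sum>i<d. (\<Sum>u\<in>S. a u * x u i)\<^sup>2)"
    by (simp add: power2_eq_square sum_product)
  finally show "0 \<le> (\<Sum>u\<in>S. \<Sum>v\<in>S. a u * a v * euclid_inner d (x u) (x v))"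
    by (simp add: sum_nonneg)
qed

text \<open>The form becomes a quadratic polynomial in the coefficient \<open>b\<close> of the new
  point; completing the square in \<open>b\<close> produces the Schur complement.\<close>

lemma quadratic_form_insert:
  fixes K :: "'a \<Rightarrow> 'a \<Rightarrow> real"
  assumes "finite S" "p \<notin> S" "\<And>u. u \<in> S \<Longrightarrow> K p u = K u p"
  shows "(\<Sum>u\<in>insert p S. \<Sum>v\<in>insert p S. (a(p := b)) u * (a(p := b)) v * K u v)
    = b\<^sup>2 * K p p + 2 * b * (\<Sum>u\<in>S. a u * K u p) + (\<Sum>u\<in>S. \<Sum>v\<in>S. a u * a v * K u v)"
proof -
  let ?a = "a(p := b)"
  have 1: "(\<Sum>v\<in>S. ?a p * ?a v * K p v) = b * (\<Sum>u\<in>S. a u * K u p)"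
    unfolding sum_distrib_left by (rule sum.cong) (use assms in auto)
  have 2: "(\<Sum>u\<in>S. \<Sum>v\<in>insert p S. ?a u * ?a v * K u v)
      = (\<Sum>u\<in>S. b * (a u * K u p) + (\<Sum>v\<in>S. a u * a v * K u v))"
  proof (rule sum.cong[OF refl])
    fix u assume u: "u \<in> S"
    have "(\<Sum>v\<in>S. ?a u * ?a v * K u v) = (\<Sum>v\<in>S. a u * a v * K u v)"
      by (rule sum.cong) (use assms u in auto)
    then show "(\<Sum>v\<in>insert p S. ?a u * ?a v * K u v)
        = b * (a u * K u p) + (\<Sum>v\<in>S. a u * a v * K u v)"
      using assms u by auto
  qed
  show ?thesis
    using assms 1 2 by (simp add: sum.distrib sum_distrib_left[symmetric] power2_eq_square del: fun_upd_apply)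
      (simp add: algebra_simps)
qed

text \<open>Coefficients on the smaller set are extended by 0.\<close>

lemma psd_on_subset:
  assumes "finite T" "psd_on T K" "S \<subseteq> T"
  shows "psd_on S K"
  unfolding psd_on_def
proof (intro conjI ballI allI)
  show "K u v = K v u" if "u \<in> S" "v \<in> S" for u v
    using assms that by (auto simp: psd_on_def)
next
  fix a :: "'a \<Rightarrow> real"
  define c where "c u = (if u \<in> S then a u else 0)" for u
  have "(\<Sum>u\<in>T. \<Sum>v\<in>T. c u * c v * K u v) = (\<Sum>u\<in>T. \<Sum>v\<in>S. c u * c v * K u v)"
    by (intro sum.cong refl sum.mono_neutral_right) (use assms c_def in auto)
  also have "\<dots> = (\<Sum>u\<in>S. \<Sum>v\<in>S. c u * c v * K u v)"
    by (intro sum.mono_neutral_right) (use assms c_def in auto)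
  also have "\<dots> = (\<Sum>u\<in>S. \<Sum>v\<in>S. a u * a v * K u v)"
    by (simp add: c_def)
  finally have *: "(\<Sum>u\<in>T. \<Sum>v\<in>T. c u * c v * K u v) = \<dots>" .
  have "0 \<le> (\<Sum>u\<in>T. \<Sum>v\<in>T. c u * c v * K u v)"
    using assms(2) unfolding psd_on_def by blast
  then show "0 \<le> (\<Sum>u\<in>S. \<Sum>v\<in>S. a u * a v * K u v)"
    unfolding * .
qed

lemma psd_on_diag_nonneg:
  assumes "finite S" "psd_on S K" "p \<in> S"
  shows "0 \<le> K p p"
proof -
  have "psd_on {p} K"
    using psd_on_subset assms by blast
  then have "\<forall>a. 0 \<le> (\<Sum>u\<in>{p}. \<Sum>v\<in>{p}. a u * a v * K u v)"
    unfolding psd_on_def by blast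
  from this[rule_format, of "\<lambda>_. 1"] show ?thesis by simp
qed

text \<open>The form with coefficient \<open>b\<close> at \<open>p\<close> and 1 at
  \<open>q\<close>, which is what controls off-diagonal entries.\<close>

lemma psd_on_pair:
  assumes "finite S" "psd_on S K" "p \<in> S" "q \<in> S" "p \<noteq> q"
  shows "0 \<le> b\<^sup>2 * K p p + 2 * b * K q p + K q q"
proof -
  have "psd_on {p, q} K"
    using psd_on_subset[of S K "{p, q}"] assms by blast
  then have "0 \<le> (\<Sum>u\<in>insert p {q}. \<Sum>v\<in>insert p {q}. ((\<lambda>_. 1)(p := b)) u * ((\<lambda>_. 1)(p := b)) v * K u v)"
    unfolding psd_on_def by blast
  moreover have "K p q = K q p"
    using assms by (auto simp: psd_on_def)
  ultimately show ?thesis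
    using quadratic_form_insert[of "{q}" p K "\<lambda>_. 1" b] assms(5)
    by (simp add: power2_eq_square)
qed

text \<open>For a zero diagonal entry the pair inequality is affine in \<open>b\<close>, and an
  affine function bounded below is constant.\<close>

lemma psd_on_zero_diag:
  assumes "finite S" "psd_on S K" "p \<in> S" "q \<in> S" "K p p = 0"
  shows "K q p = 0"
proof (cases "p = q")
  case False
  have *: "0 \<le> 2 * b * K q p + K q q" for b
    using psd_on_pair[OF assms(1-4) False, of b] assms(5) by simp
  show ?thesis
  proof (rule ccontr)
    assume "K q p \<noteq> 0"
    \<comment> \<open>This choice of \<open>b\<close> makes the affine expression equal to
      -1.\<close>
    then show False
      using *[of "- (K q q + 1) / (2 * K q p)"] by (simp add: field_simps)
  qed
qed (use assms in auto)

text \<open>Cholesky decomposition: the Schur complement of one entry is again positive semidefinite,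
  and that entry contributes one new coordinate. If the pivot \<open>K p p\<close> vanishes, so does its
  column, and the divisions by zero give the right value \<open>0\<close>.\<close>

lemma psd_on_imp_Gram:
  assumes "finite S" "psd_on S K"
  shows "\<exists>d x. \<forall>u\<in>S. \<forall>v\<in>S. euclid_inner d (x u) (x v) = K u v"
  using assms
proof (induction S arbitrary: K rule: finite_induct)
  case (insert p S)
  note psd = insert.prems
  have fin: "finite (insert p S)" using insert.hyps by simp
  have sym: "K u v = K v u" if "u \<in> insert p S" "v \<in> insert p S" for u v
    using psd that unfolding psd_on_def by blast
  define K' where "K' u v = K u v - K u p * K v p / K p p" for u v
  have nn: "0 \<le> K p p"
    using psd_on_diag_nonneg[OF fin psd] by simp
  have z: "K u p = 0" if "K p p = 0" "u \<in> S" for u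
    using psd_on_zero_diag[OF fin psd] that by auto
  have "psd_on S K'"
    unfolding psd_on_def
  proof (intro conjI ballI allI)
    show "K' u v = K' v u" if "u \<in> S" "v \<in> S" for u v
      using sym[of u v] that by (simp add: K'_def)
  next
    fix a :: "'a \<Rightarrow> real"
    define L where "L = (\<Sum>u\<in>S. a u * K u p)"
    \<comment> \<open>For \<open>K p p > 0\<close> this minimises the polynomial in the coefficient
      at \<open>p\<close>, and the minimum is the form of the Schur complement
      \<open>K'\<close>.\<close>
    let ?b = "- L / K p p"
    have "(\<Sum>u\<in>S. \<Sum>v\<in>S. a u * a v * K' u v)
        = (\<Sum>u\<in>S. \<Sum>v\<in>S. a u * a v * K u v - (a u * K u p) * (a v * K v p) / K p p)"
      by (simp add: K'_def algebra_simps)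
    also have "\<dots> = (\<Sum>u\<in>S. \<Sum>v\<in>S. a u * a v * K u v) - L * L / K p p"
      by (simp add: L_def sum_product sum_subtractf sum_divide_distrib)
    also have "\<dots> = ?b\<^sup>2 * K p p + 2 * ?b * L + (\<Sum>u\<in>S. \<Sum>v\<in>S. a u * a v * K u v)"
      by (cases "K p p = 0") (auto simp: field_simps power2_eq_square)
    also have "\<dots> = (\<Sum>u\<in>insert p S. \<Sum>v\<in>insert p S. (a(p := ?b)) u * (a(p := ?b)) v * K u v)"
      unfolding L_def by (rule quadratic_form_insert[symmetric]) (use insert.hyps sym in auto)
    also have "\<dots> \<ge> 0"
      using psd unfolding psd_on_def by blast
    finally show "0 \<le> (\<Sum>u\<in>S. \<Sum>v\<in>S. a u * a v * K' u v)" .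
  qed
  from insert.IH[OF this] obtain d x where
    x: "\<And>u v. u \<in> S \<Longrightarrow> v \<in> S \<Longrightarrow> euclid_inner d (x u) (x v) = K' u v"
    by blast
  \<comment> \<open>The old coordinates of \<open>p\<close> are 0; coordinate \<open>d\<close> is
    the new one, equal to \<open>sqrt (K p p)\<close> for \<open>p\<close> itself.\<close>
  define y where "y u i = (if i < d then if u = p then 0 else x u i else K u p / sqrt (K p p))" for u i
  have "euclid_inner (Suc d) (y u) (y v) = K u v" if "u \<in> insert p S" "v \<in> insert p S" for u v
  proof -
    have "euclid_inner (Suc d) (y u) (y v)
        = (\<Sum>i<d. if u = p \<or> v = p then 0 else x u i * x v i) + K u p * K v p / K p p"
      using nn by (auto simp: euclid_inner_def y_def intro!: sum.cong)
    also have "(\<Sum>i<d. if u = p \<or> v = p then 0 else x u i * x v i) = (if u = p \<or> v = p then 0 else K' u v)"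
      using x[of u v] that by (auto simp: euclid_inner_def)
    also have "\<dots> + K u p * K v p / K p p = K u v"
      using that sym[of u v] z by (auto simp: K'_def)
    finally show ?thesis .
  qed
  then show ?case by blast
qed auto

section \<open>Compactness and closedness of the set of feasible values\<close>

text \<open>Bolzano-Weierstrass, one coordinate at a time: each new coordinate passes to a monotone
  subsequence, which keeps the convergence of the earlier ones.\<close>

lemma finite_convergent_subsequence:
  fixes f :: "nat \<Rightarrow> 'b \<Rightarrow> real"
  assumes "finite S" "\<And>n s. s \<in> S \<Longrightarrow> \<bar>f n s\<bar> \<le> B"
  shows "\<exists>r. strict_mono r \<and> (\<forall>s\<in>S. convergent (\<lambda>n. f (r n) s))"
  using assms
proof (induction S rule: finite_induct)
  case empty
  then show ?case by (intro exI[of _ id]) (auto simp: strict_mono_def)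
next
  case (insert a S)
  then obtain r where r: "strict_mono r" "\<And>s. s \<in> S \<Longrightarrow> convergent (\<lambda>n. f (r n) s)"
    by auto
  obtain q where q: "strict_mono q" "monoseq (\<lambda>n. f (r (q n)) a)"
    using seq_monosub[of "\<lambda>n. f (r n) a"] by auto
  have "Bseq (\<lambda>n. f (r (q n)) a)"
    using insert.prems by (intro BseqI'[of _ B]) auto
  then have "convergent (\<lambda>n. f (r (q n)) a)"
    using q Bseq_monoseq_convergent by blast
  moreover have "convergent (\<lambda>n. f (r (q n)) s)" if "s \<in> S" for s
    using convergent_subseq_convergent[OF r(2)[OF that] q(1)] by (simp add: o_def)
  ultimately show ?case
    using strict_mono_o[OF r(1) q(1)] by (intro exI[of _ "r \<circ> q"]) (auto simp: o_def)
qed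

text \<open>Trading the vectors for their Gram matrix removes the unbounded dimension: a feasible
  configuration becomes finitely many entries, and limits can be taken entrywise.\<close>

lemma theta_feasible_iff_psd:
  assumes "finite (verts F)"
  shows "theta_feasible F \<kappa> \<longleftrightarrow> \<kappa> \<ge> 2 \<and>
    (\<exists>K. psd_on (verts F) K \<and> (\<forall>v\<in>verts F. K v v = 1) \<and>
      (\<forall>u\<in>verts F. \<forall>v\<in>verts F. u \<noteq> v \<longrightarrow> {u, v} \<notin> edges F \<longrightarrow> K u v = - (1 / (\<kappa> - 1))))"
    (is "_ \<longleftrightarrow> _ \<and> (\<exists>K. ?P K)")
proof
  assume L: "theta_feasible F \<kappa>"
  then obtain d and x :: "'a \<Rightarrow> nat \<Rightarrow> real" where
    "\<forall>v\<in>verts F. euclid_inner d (x v) (x v) = 1"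
    "\<forall>u\<in>verts F. \<forall>v\<in>verts F. u \<noteq> v \<longrightarrow> {u, v} \<notin> edges F \<longrightarrow>
      euclid_inner d (x u) (x v) = - (1 / (\<kappa> - 1))"
    unfolding theta_feasible_def by auto
  then have "?P (\<lambda>u v. euclid_inner d (x u) (x v))"
    by (intro conjI psd_on_Gram)
  then have "\<exists>K. ?P K"
    by (rule exI[of ?P])
  moreover have "\<kappa> \<ge> 2"
    using L unfolding theta_feasible_def by (rule conjunct1)
  ultimately show "\<kappa> \<ge> 2 \<and> (\<exists>K. ?P K)"
    by (rule conjI[rotated])
next
  assume "\<kappa> \<ge> 2 \<and> (\<exists>K. ?P K)"
  then have "\<kappa> \<ge> 2" and "\<exists>K. ?P K"
    by (rule conjunct1, rule conjunct2)
  from this(2) obtain K where K: "?P K" ..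
  then obtain d and x :: "'a \<Rightarrow> nat \<Rightarrow> real" where
    "\<forall>u\<in>verts F. \<forall>v\<in>verts F. euclid_inner d (x u) (x v) = K u v"
    using psd_on_imp_Gram[OF assms] by metis
  then have "(\<forall>v\<in>verts F. euclid_inner d (x v) (x v) = 1) \<and>
    (\<forall>u\<in>verts F. \<forall>v\<in>verts F. u \<noteq> v \<longrightarrow> {u, v} \<notin> edges F \<longrightarrow>
      euclid_inner d (x u) (x v) = - (1 / (\<kappa> - 1)))"
    using K by simp
  then show "theta_feasible F \<kappa>"
    unfolding theta_feasible_def using \<open>\<kappa> \<ge> 2\<close>
    by (intro conjI exI[of _ d] exI[of _ x]) simp_all
qed

text \<open>The matrix is (1 + t) I - t J with J all ones. By Cauchy-Schwarz it is positive
  semidefinite once n t <= 1 + t for n vertices, and 1 + t equals \<kappa> t. Hence the set of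
  feasible values is nonempty.\<close>

lemma theta_feasible_simplex:
  assumes fin: "finite (verts F)" and \<kappa>: "\<kappa> \<ge> 2" "\<kappa> \<ge> real (card (verts F))"
  shows "theta_feasible F \<kappa>"
proof -
  let ?V = "verts F"
  define t where "t = 1 / (\<kappa> - 1)"
  define K where "K u v = (if u = v then 1 + t else 0) - t" for u v :: 'a
  have t: "t > 0"
    using \<kappa> by (simp add: t_def)
  have "(\<kappa> - 1) * t = 1"
    using \<kappa> by (simp add: t_def)
  moreover have "real (card ?V) * t \<le> \<kappa> * t"
    using \<kappa> t by (intro mult_right_mono) auto
  ultimately have t2: "real (card ?V) * t \<le> 1 + t"
    by (simp add: algebra_simps)
  have "0 \<le> (\<Sum>u\<in>?V. \<Sum>v\<in>?V. a u * a v * K u v)" for a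
  proof -
    have "(\<Sum>u\<in>?V. \<Sum>v\<in>?V. a u * a v * K u v)
        = (\<Sum>u\<in>?V. \<Sum>v\<in>?V. (if u = v then (1 + t) * (a u * a v) else 0) - t * (a u * a v))"
      by (intro sum.cong refl) (auto simp: K_def algebra_simps)
    also have "\<dots> = (1 + t) * (\<Sum>u\<in>?V. (a u)\<^sup>2) - t * (\<Sum>u\<in>?V. a u)\<^sup>2"
      using fin by (simp add: sum_subtractf sum_product power2_eq_square
          sum_distrib_left[symmetric] sum.delta)
    also have "t * (\<Sum>u\<in>?V. a u)\<^sup>2 \<le> t * (real (card ?V) * (\<Sum>u\<in>?V. (a u)\<^sup>2))"
      using t sum_squared_le_sum_of_squares[of a ?V] by (intro mult_left_mono) (auto simp: mult.commute)
    moreover have "\<dots> \<le> (1 + t) * (\<Sum>u\<in>?V. (a u)\<^sup>2)"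
      using mult_right_mono[OF t2, of "\<Sum>u\<in>?V. (a u)\<^sup>2"] by (simp add: sum_nonneg algebra_simps)
    ultimately show ?thesis by simp
  qed
  then have "psd_on ?V K"
    by (auto simp: psd_on_def K_def)
  then show ?thesis
    using \<kappa> theta_feasible_iff_psd[OF fin] by (auto simp: K_def t_def)
qed

lemma theta_feasible_limit:
  assumes fin: "finite (verts F)" and feas: "\<And>n. theta_feasible F (\<kappa> n)" and lim: "\<kappa> \<longlonglongrightarrow> \<kappa>0"
  shows "theta_feasible F \<kappa>0"
proof -
  let ?V = "verts F"
  have "\<forall>n. \<kappa> n \<ge> 2 \<and>
    (\<exists>K. psd_on ?V K \<and> (\<forall>v\<in>?V. K v v = 1) \<and>
      (\<forall>u\<in>?V. \<forall>v\<in>?V. u \<noteq> v \<longrightarrow> {u, v} \<notin> edges F \<longrightarrow> K u v = - (1 / (\<kappa> n - 1))))"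
    using feas unfolding theta_feasible_iff_psd[OF fin] by (rule allI)
  then obtain K where two: "\<And>n. \<kappa> n \<ge> 2" and psd: "\<And>n. psd_on ?V (K n)"
    and diag: "\<And>n v. v \<in> ?V \<Longrightarrow> K n v v = 1"
    and off: "\<And>n u v. u \<in> ?V \<Longrightarrow> v \<in> ?V \<Longrightarrow> u \<noteq> v \<Longrightarrow> {u, v} \<notin> edges F \<Longrightarrow>
      K n u v = - (1 / (\<kappa> n - 1))"
    by metis
  have bound: "\<bar>K n u v\<bar> \<le> 1" if "u \<in> ?V" "v \<in> ?V" for n u v
  proof (cases "u = v")
    case False
    \<comment> \<open>Coefficients (1, 1) and (-1, 1) with unit diagonal give 2 + 2 K >= 0 and 2 - 2
      K >= 0 for the entry K.\<close>
    then show ?thesis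
      using psd_on_pair[OF fin psd[of n] that(2) that(1), of 1]
        psd_on_pair[OF fin psd[of n] that(2) that(1), of "-1"] diag that by simp
  qed (use diag that in simp)
  obtain r where r: "strict_mono r"
    "\<And>s. s \<in> ?V \<times> ?V \<Longrightarrow> convergent (\<lambda>n. (\<lambda>(u, v). K (r n) u v) s)"
    using finite_convergent_subsequence[of "?V \<times> ?V" "\<lambda>n (u, v). K n u v" 1] fin bound by fastforce
  define K0 where "K0 u v = lim (\<lambda>n. K (r n) u v)" for u v
  have K0: "(\<lambda>n. K (r n) u v) \<longlonglongrightarrow> K0 u v" if "u \<in> ?V" "v \<in> ?V" for u v
    using r(2)[of "(u, v)"] that by (simp add: K0_def convergent_LIMSEQ_iff)
  have k: "(\<lambda>n. \<kappa> (r n)) \<longlonglongrightarrow> \<kappa>0"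
    using LIMSEQ_subseq_LIMSEQ[OF lim r(1)] by (simp add: o_def)
  have two0: "\<kappa>0 \<ge> 2"
    using LIMSEQ_le_const[OF lim] two by blast
  have "psd_on ?V K0"
    unfolding psd_on_def
  proof (intro conjI ballI allI)
    show "K0 u v = K0 v u" if "u \<in> ?V" "v \<in> ?V" for u v
    proof -
      have "K n u v = K n v u" for n
        using psd[of n] that unfolding psd_on_def by blast
      then show ?thesis by (simp add: K0_def)
    qed
  next
    fix a :: "'a \<Rightarrow> real"
    have "(\<lambda>n. \<Sum>u\<in>?V. \<Sum>v\<in>?V. a u * a v * K (r n) u v) \<longlonglongrightarrow> (\<Sum>u\<in>?V. \<Sum>v\<in>?V. a u * a v * K0 u v)"
      by (intro tendsto_intros K0)
    then show "0 \<le> (\<Sum>u\<in>?V. \<Sum>v\<in>?V. a u * a v * K0 u v)"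
      using psd unfolding psd_on_def by (intro LIMSEQ_le_const) auto
  qed
  moreover have "K0 v v = 1" if "v \<in> ?V" for v
    using diag that by (simp add: K0_def)
  moreover have "K0 u v = - (1 / (\<kappa>0 - 1))"
    if uv: "u \<in> ?V" "v \<in> ?V" "u \<noteq> v" "{u, v} \<notin> edges F" for u v
  proof -
    \<comment> \<open>\<open>\<kappa>0 \<ge> 2\<close> keeps the denominator of the limit away from
      0.\<close>
    have "(\<lambda>n. K (r n) u v) \<longlonglongrightarrow> - (1 / (\<kappa>0 - 1))"
      unfolding off[OF uv] using two0 by (intro tendsto_intros k) auto
    then show ?thesis
      using K0[OF uv(1,2)] LIMSEQ_unique by blast
  qed
  ultimately show ?thesis
    unfolding theta_feasible_iff_psd[OF fin] using two0
    by (intro conjI exI[of _ K0]) simp_all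
qed

text \<open>\<open>LEAST\<close> is informative only if the minimum is attained; a nonempty closed
  set that is bounded below contains its infimum.\<close>

lemma theta_feasible_lovasz_theta:
  assumes fin: "finite (verts F)"
  shows "theta_feasible F (lovasz_theta F)"
proof -
  let ?S = "{\<kappa>. theta_feasible F \<kappa>}"
  have bdd: "bdd_below ?S"
    by (rule bdd_belowI[of _ 2]) (auto simp: theta_feasible_def)
  have ne: "?S \<noteq> {}"
    using theta_feasible_simplex[OF fin, of "max 2 (real (card (verts F)))"] by auto
  have "closed ?S"
    unfolding closed_sequential_limits
  proof (intro allI impI)
    fix \<kappa> l assume "(\<forall>n. \<kappa> n \<in> ?S) \<and> \<kappa> \<longlonglongrightarrow> l"
    then show "l \<in> ?S"
      using theta_feasible_limit[OF fin, of \<kappa> l] by simp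
  qed
  then have "theta_feasible F (Inf ?S)"
    using closed_contains_Inf[OF ne bdd] by simp
  moreover have "lovasz_theta F = Inf ?S"
    unfolding lovasz_theta_def
    using calculation bdd by (intro Least_equality) (simp_all add: cInf_lower)
  ultimately show ?thesis by simp
qed

section \<open>Gaussian projections\<close>

definition gauss :: "nat \<Rightarrow> (nat \<Rightarrow> real) measure" where
  "gauss d = Pi\<^sub>M {..<d} (\<lambda>_. std_normal_distribution)"

lemma prob_space_gauss: "prob_space (gauss d)"
  unfolding gauss_def by (intro prob_space_PiM prob_space_normal_density) simp

lemma measurable_euclid_inner_gauss [measurable]:
  "(\<lambda>g. euclid_inner d g z) \<in> borel_measurable (gauss d)"
proof -
  have "(\<lambda>g. g i) \<in> borel_measurable (gauss d)" if "i < d" for i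
    unfolding gauss_def using measurable_component_singleton[of i "{..<d}" "\<lambda>_. std_normal_distribution"] that
    by simp
  then show ?thesis
    unfolding euclid_inner_def by (intro borel_measurable_sum borel_measurable_times) auto
qed

lemma integrable_gauss_bounded:
  fixes f :: "_ \<Rightarrow> 'b::{banach, second_countable_topology}"
  assumes "f \<in> borel_measurable (gauss d)" "\<And>g. norm (f g) \<le> B"
  shows "integrable (gauss d) f"
proof -
  interpret prob_space "gauss d" by (rule prob_space_gauss)
  show ?thesis
    using assms by (intro integrable_const_bound[of _ B]) auto
qed

text \<open>By independence the characteristic function factors into one-dimensional ones.\<close>

lemma gauss_iexp:
  "(\<integral>g. iexp (euclid_inner d g z) \<partial>gauss d) = exp (- euclid_inner d z z / 2)"
proof -
  interpret product_sigma_finite "\<lambda>_::nat. std_normal_distribution"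
    by (simp add: product_sigma_finite_def prob_space_normal_density prob_space_imp_sigma_finite)
  interpret N: real_distribution std_normal_distribution
    by (rule real_dist_normal_dist)
  have "(\<integral>g. iexp (euclid_inner d g z) \<partial>gauss d)
      = (\<integral>g. (\<Prod>i<d. iexp (z i * g i)) \<partial>gauss d)"
    by (simp add: euclid_inner_def exp_sum[symmetric] sum_distrib_left mult_ac)
  also have "\<dots> = (\<Prod>i<d. char std_normal_distribution (z i))"
    unfolding gauss_def char_def
    by (intro product_integral_prod) (auto intro!: N.integrable_iexp)
  also have "\<dots> = exp (- euclid_inner d z z / 2)"
    unfolding char_std_normal_distribution
    by (simp add: euclid_inner_def of_real_prod[symmetric] exp_sum[symmetric] sum_negf
        sum_divide_distrib power2_eq_square del: of_real_prod)
  finally show ?thesis .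
qed

lemma gauss_cos:
  "(\<integral>g. cos (euclid_inner d g z) \<partial>gauss d) = exp (- euclid_inner d z z / 2)"
proof -
  have "integrable (gauss d) (\<lambda>g. iexp (euclid_inner d g z))"
    by (rule integrable_gauss_bounded[of _ _ 1]) auto
  then have "(\<integral>g. Re (iexp (euclid_inner d g z)) \<partial>gauss d) = Re (exp (- euclid_inner d z z / 2))"
    by (simp only: integral_Re gauss_iexp)
  then show ?thesis
    by (simp add: Re_exp)
qed

lemma euclid_inner_combination:
  "euclid_inner d g (\<lambda>i. a * x i + b * y i) = a * euclid_inner d g x + b * euclid_inner d g y"
  by (simp add: euclid_inner_def sum_distrib_left sum.distrib algebra_simps)

lemma euclid_inner_commute: "euclid_inner d x y = euclid_inner d y x"
  by (simp add: euclid_inner_def mult.commute)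

text \<open>The product of sines is half the difference of the cosines of the projections of a x - b
  y and a x + b y. Their squared norms differ only in the sign of 2 a b \<rho>, so the two
  exponentials combine to a sinh.\<close>

lemma gauss_sin_sin:
  assumes "euclid_inner d x x = 1" "euclid_inner d y y = 1"
  shows "(\<integral>g. sin (a * euclid_inner d g x) * sin (b * euclid_inner d g y) \<partial>gauss d)
    = exp (- a\<^sup>2 / 2) * exp (- b\<^sup>2 / 2) * sinh (a * b * euclid_inner d x y)"
proof -
  define \<rho> where "\<rho> = euclid_inner d x y"
  \<comment> \<open>The coefficient of \<open>y\<close> is a parameter so that \<open>z b\<close>
    and \<open>z (- b)\<close> share one computation.\<close>
  define z where "z b i = a * x i + b * y i" for b i
  have z: "euclid_inner d g (z b) = a * euclid_inner d g x + b * euclid_inner d g y" for g b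
    unfolding z_def by (rule euclid_inner_combination)
  have q: "euclid_inner d (z b) (z b) = a\<^sup>2 + b\<^sup>2 + 2 * a * b * \<rho>" for b
    unfolding z by (subst (1 2) euclid_inner_commute)
      (simp add: z assms \<rho>_def euclid_inner_commute[of d y x] power2_eq_square algebra_simps)
  have int: "integrable (gauss d) (\<lambda>g. cos (euclid_inner d g w))" for w
    by (rule integrable_gauss_bounded[of _ _ 1]) auto
  have "(\<integral>g. sin (a * euclid_inner d g x) * sin (b * euclid_inner d g y) \<partial>gauss d)
    = (\<integral>g. (cos (euclid_inner d g (z (- b))) - cos (euclid_inner d g (z b))) / 2 \<partial>gauss d)"
    by (simp add: z sin_times_sin)
  also have "\<dots> = (exp (- (a\<^sup>2 + b\<^sup>2 - 2 * a * b * \<rho>) / 2) - exp (- (a\<^sup>2 + b\<^sup>2 + 2 * a * b * \<rho>) / 2)) / 2"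
    by (simp add: int gauss_cos q)
  also have "\<dots> = exp (- a\<^sup>2 / 2) * exp (- b\<^sup>2 / 2) * sinh (a * b * \<rho>)"
    by (simp add: sinh_field_def exp_add[symmetric] diff_divide_distrib
        add_divide_distrib right_diff_distrib algebra_simps)
  finally show ?thesis by (simp add: \<rho>_def)
qed

section \<open>Fejer means of the square wave\<close>

lemma le_sinh:
  fixes x :: real
  assumes "0 \<le> x"
  shows "x \<le> sinh x"
  using real_le_x_sinh[OF assms] by (simp add: sinh_field_def exp_minus)

text \<open>Here \<open>c\<close> will be a product of two frequencies, of either sign. For c > 0
  oddness gives sinh (c u) <= c u; for c < 0 the inequality is the opposite one, and dividing by
  \<open>c\<close> reverses it.\<close>

lemma sinh_scaled_le:
  fixes c u :: real
  assumes "c \<noteq> 0" "u \<le> 0"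
  shows "sinh (c * u) / c \<le> u"
proof (cases "c > 0")
  case True
  have "- (c * u) \<le> sinh (- (c * u))"
    using True assms by (intro le_sinh) (auto simp: mult_nonneg_nonpos)
  then show ?thesis using True by (simp add: field_simps)
next
  case False
  then have "c < 0" using assms by simp
  have "c * u \<le> sinh (c * u)"
    using \<open>c < 0\<close> assms by (intro le_sinh) (auto simp: mult_nonpos_nonpos)
  then show ?thesis using \<open>c < 0\<close> by (simp add: field_simps)
qed

definition odd_pairs :: "nat \<Rightarrow> (nat \<times> nat) set" where
  "odd_pairs n = {(i, j). i < n \<and> j < n \<and> odd (i + j)}"

text \<open>The Fejer mean of the square wave sgn (sin p), whose series is 4 / pi times the sum of
  sin (k p) / k over odd k > 0. A difference k arises from n - |k| pairs, which gives the Fejer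
  damping, and k and -k contribute equally.\<close>

definition fejer :: "nat \<Rightarrow> real \<Rightarrow> real" where
  "fejer n p = 2 / (pi * real n) *
     (\<Sum>(i, j)\<in>odd_pairs n. sin ((real i - real j) * p) / (real i - real j))"

lemma finite_odd_pairs [simp]: "finite (odd_pairs n)"
  by (rule finite_subset[of _ "{..<n} \<times> {..<n}"]) (auto simp: odd_pairs_def)

lemma sin_nat_diff_shift_pi:
  "sin ((real i - real j) * (p + pi)) = (-1) ^ (i + j) * sin ((real i - real j) * p)"
proof -
  have s: "sin ((real i - real j) * pi) = 0"
    by (simp add: left_diff_distrib sin_diff)
  have c: "cos ((real i - real j) * pi) = (-1) ^ (i + j)"
    by (simp add: left_diff_distrib cos_diff power_add)
  show ?thesis
    by (simp add: distrib_left sin_add s c)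
qed

text \<open>The primitive \<open>G\<close> of the Fejer kernel increases by \<open>2 \<pi>\<close> over a period, and
  \<open>fejer n p\<close> is \<open>1 - (G (p + \<pi>) - G p) / \<pi>\<close>.\<close>

lemma abs_fejer_le_1:
  assumes n: "n > 0"
  shows "\<bar>fejer n p\<bar> \<le> 1"
proof -
  let ?A = "{..<n} \<times> {..<n}"
  define D where "D = {(i, j) \<in> ?A. i \<noteq> j}"
  define k where "k = (\<lambda>(i::nat, j::nat). real i - real j)"
  define G where "G p = p + (\<Sum>z\<in>D. sin (k z * p) / k z) / n" for p
  have finD: "finite D"
    by (rule finite_subset[of _ ?A]) (auto simp: D_def)
  have k0: "k z \<noteq> 0" if "z \<in> D" for z
    using that by (auto simp: D_def k_def)
  have deriv: "(G has_real_derivative 1 + (\<Sum>z\<in>D. cos (k z * p)) / n) (at p)" for p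
  proof -
    have "((\<lambda>p. sin (k z * p) / k z) has_real_derivative cos (k z * p)) (at p)" if "z \<in> D" for z
      using k0[OF that] by (auto intro!: derivative_eq_intros)
    then show ?thesis
      unfolding G_def by (intro DERIV_add DERIV_ident DERIV_cdivide DERIV_sum)
  qed
  \<comment> \<open>Times n, this is the squared modulus of the sum of exp (i l p) over l < n; the
    diagonal pairs outside \<open>D\<close> supply the constant n.\<close>
  have nonneg: "1 + (\<Sum>z\<in>D. cos (k z * p)) / n \<ge> 0" for p
  proof -
    have "(\<Sum>z\<in>?A. cos (k z * p)) = (\<Sum>z\<in>D. cos (k z * p)) + (\<Sum>z\<in>?A - D. cos (k z * p))"
      by (intro sum.subset_diff[THEN trans[OF _ add.commute]]) (auto simp: D_def)
    also have "(\<Sum>z\<in>?A - D. cos (k z * p)) = (\<Sum>z\<in>(\<lambda>i. (i, i)) ` {..<n}. cos (k z * p))"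
      by (rule sum.cong) (auto simp: D_def)
    also have "\<dots> = n"
      by (subst sum.reindex) (auto simp: k_def inj_on_def)
    finally have "(\<Sum>z\<in>D. cos (k z * p)) + n = (\<Sum>z\<in>?A. cos (k z * p))" by simp
    also have "\<dots> = (\<Sum>i<n. cos (i * p))\<^sup>2 + (\<Sum>i<n. sin (i * p))\<^sup>2"
      by (simp add: power2_eq_square sum_product sum.cartesian_product sum.distrib[symmetric]
          k_def case_prod_beta left_diff_distrib cos_diff)
    also have "\<dots> \<ge> 0" by simp
    finally show ?thesis using n by (simp add: field_simps)
  qed
  have mono: "G p \<le> G q" if "p \<le> q" for p q
    using deriv nonneg that by (intro DERIV_nonneg_imp_nondecreasing[of p q G]) blast+
  have shift: "sin (k z * (p + pi)) = (-1) ^ (fst z + snd z) * sin (k z * p)" for z p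
    using sin_nat_diff_shift_pi by (simp add: k_def case_prod_beta)
  have period: "G (p + 2 * pi) = G p + 2 * pi" for p
  proof -
    have "sin (k z * (p + 2 * pi)) = sin (k z * p)" for z
    proof -
      have "p + 2 * pi = p + pi + pi" by simp
      then have "sin (k z * (p + 2 * pi)) = sin (k z * (p + pi + pi))" by (simp only:)
      then show ?thesis
        unfolding shift by (simp add: minus_one_power_iff)
    qed
    then show ?thesis by (simp add: G_def)
  qed
  \<comment> \<open>A shift by pi flips the sign of exactly the terms with odd difference, so even
    ones cancel and odd ones double.\<close>
  have "(\<Sum>z\<in>D. sin (k z * p) / k z) - (\<Sum>z\<in>D. sin (k z * (p + pi)) / k z)
      = (\<Sum>z\<in>D. if odd (fst z + snd z) then 2 * (sin (k z * p) / k z) else 0)"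
    unfolding sum_subtractf[symmetric] shift by (intro sum.cong) auto
  also have "\<dots> = (\<Sum>z\<in>{z \<in> D. odd (fst z + snd z)}. 2 * (sin (k z * p) / k z))"
    by (rule sum.inter_filter[OF finD, symmetric])
  also have "{z \<in> D. odd (fst z + snd z)} = odd_pairs n"
    by (auto simp: D_def odd_pairs_def)
  also have "(\<Sum>z\<in>odd_pairs n. 2 * (sin (k z * p) / k z)) = pi * n * fejer n p"
    unfolding sum_distrib_left[symmetric] using n by (simp add: fejer_def k_def case_prod_beta)
  finally have "real n * (pi * fejer n p) = real n * (G p - G (p + pi) + pi)"
    using n by (simp add: G_def ring_distribs)
  then have "pi * fejer n p = G p - G (p + pi) + pi"
    using n by simp
  \<comment> \<open>With the period, the increment of \<open>G\<close> from p to p + pi lies between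
    0 and 2 pi.\<close>
  moreover have "G p \<le> G (p + pi)" "G (p + pi) \<le> G (p + 2 * pi)"
    by (auto intro: mono)
  ultimately have "\<bar>pi * fejer n p\<bar> \<le> pi"
    using period[of p] by linarith
  then show ?thesis
    by (simp add: abs_mult)
qed

section \<open>Gaussian correlation of Fejer means\<close>

text \<open>For a standard normal X this is the expectation of X f(X), where f(s) is
  \<open>fejer n (\<epsilon> * s)\<close>, since E X sin (a X) = a exp (- a^2 / 2). The sign
  function would give E |X| = sqrt (2 / pi).\<close>

definition fejer_weight :: "nat \<Rightarrow> real \<Rightarrow> real" where
  "fejer_weight n \<epsilon> = 2 * \<epsilon> / (pi * real n) *
     (\<Sum>(i, j)\<in>odd_pairs n. exp (- (\<epsilon> * (real i - real j))\<^sup>2 / 2))"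

lemma continuous_on_fejer: "continuous_on A (fejer n)"
  unfolding fejer_def case_prod_beta by (cases "n = 0") (auto intro!: continuous_intros simp: odd_pairs_def)

lemma measurable_fejer [measurable]: "fejer n \<in> borel_measurable borel"
  by (intro borel_measurable_continuous_onI continuous_on_fejer)

text \<open>Both means expand into a double sum with positive weights \<open>h z * h w\<close>, so
  each sinh can be replaced by its linear part. The denominators then cancel and the double sum is a
  square.\<close>

lemma gauss_fejer_fejer_le:
  assumes "euclid_inner d x x = 1" "euclid_inner d y y = 1" "euclid_inner d x y \<le> 0"
  shows "(\<integral>g. fejer n (\<epsilon> * euclid_inner d g x) * fejer n (\<epsilon> * euclid_inner d g y) \<partial>gauss d)
    \<le> euclid_inner d x y * (fejer_weight n \<epsilon>)\<^sup>2"
proof -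
  define k where "k = (\<lambda>(i::nat, j::nat). real i - real j)"
  define c where "c = 2 / (pi * real n)"
  define \<rho> where "\<rho> = euclid_inner d x y"
  define X where "X v z g = sin (k z * \<epsilon> * euclid_inner d g v)" for v z g
  define h where "h z = exp (- (k z * \<epsilon>)\<^sup>2 / 2)" for z
  let ?P = "odd_pairs n"
  have k0: "k z \<noteq> 0" if "z \<in> ?P" for z
    using that by (auto simp: odd_pairs_def k_def)
  have f: "fejer n (\<epsilon> * euclid_inner d g v) = c * (\<Sum>z\<in>?P. X v z g / k z)" for g v
    by (simp add: fejer_def c_def X_def k_def case_prod_beta mult.assoc)
  have int: "integrable (gauss d) (\<lambda>g. X x z g * X y w g)" for z w
    unfolding X_def
    by (rule integrable_gauss_bounded[of _ _ 1]) (auto simp: abs_mult intro!: mult_le_one)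
  have "(\<integral>g. fejer n (\<epsilon> * euclid_inner d g x) * fejer n (\<epsilon> * euclid_inner d g y) \<partial>gauss d)
    = (\<integral>g. c\<^sup>2 * (\<Sum>z\<in>?P. \<Sum>w\<in>?P. X x z g * X y w g / (k z * k w)) \<partial>gauss d)"
    unfolding f by (simp add: power2_eq_square sum_product mult_ac)
  also have "\<dots> = c\<^sup>2 * (\<Sum>z\<in>?P. \<Sum>w\<in>?P. (\<integral>g. X x z g * X y w g \<partial>gauss d) / (k z * k w))"
    by (simp add: int)
  also have "\<dots> \<le> c\<^sup>2 * (\<Sum>z\<in>?P. \<Sum>w\<in>?P. h z * h w * (\<epsilon>\<^sup>2 * \<rho>))"
  proof (intro mult_left_mono sum_mono)
    fix z w assume zw: "z \<in> ?P" "w \<in> ?P"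
    have "(\<integral>g. X x z g * X y w g \<partial>gauss d) / (k z * k w)
        = h z * h w * (sinh (k z * k w * (\<epsilon>\<^sup>2 * \<rho>)) / (k z * k w))"
      unfolding X_def gauss_sin_sin[OF assms(1,2)] by (simp add: h_def \<rho>_def power2_eq_square mult_ac)
    also have "\<dots> \<le> h z * h w * (\<epsilon>\<^sup>2 * \<rho>)"
      using assms(3) k0 zw
      by (intro mult_left_mono sinh_scaled_le) (auto simp: h_def \<rho>_def mult_nonneg_nonpos)
    finally show "(\<integral>g. X x z g * X y w g \<partial>gauss d) / (k z * k w) \<le> h z * h w * (\<epsilon>\<^sup>2 * \<rho>)" .
  qed simp
  also have "\<dots> = \<rho> * (\<epsilon> * c * (\<Sum>z\<in>?P. h z))\<^sup>2"
    by (simp add: sum_product power2_eq_square sum_distrib_left mult_ac)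
  also have "\<epsilon> * c * (\<Sum>z\<in>?P. h z) = fejer_weight n \<epsilon>"
    by (simp add: fejer_weight_def c_def h_def k_def case_prod_beta mult_ac)
  finally show ?thesis by (simp add: \<rho>_def)
qed

section \<open>Riemann sums for the Gaussian integral and the limiting constant\<close>

text \<open>The integral of exp (- x^2) from 0 to \<open>y\<close>; the two indicators match the
  forms of \<open>tendsto_integral_at_top\<close> and \<open>gaussian_moment_0\<close>.\<close>

definition gauss_primitive :: "real \<Rightarrow> real" where
  "gauss_primitive y = (\<integral>x. indicator {..y} x *\<^sub>R (indicator {0..} x *\<^sub>R exp (- x\<^sup>2)) \<partial>lborel)"

lemma gauss_primitive_tendsto: "(gauss_primitive \<longlongrightarrow> sqrt pi / 2) at_top"
  unfolding gauss_primitive_def has_bochner_integral_integral_eq[OF gaussian_moment_0, symmetric]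
  by (intro tendsto_integral_at_top integrable.intros[OF gaussian_moment_0]) simp

text \<open>The integrand decreases on the nonnegative axis, so its value at the left endpoint
  dominates.\<close>

lemma gauss_primitive_diff_le:
  assumes "0 \<le> a" "a \<le> b"
  shows "gauss_primitive b - gauss_primitive a \<le> (b - a) * exp (- a\<^sup>2)"
proof -
  let ?f = "\<lambda>x::real. indicator {0..} x *\<^sub>R exp (- x\<^sup>2) :: real"
  have f: "integrable lborel ?f"
    by (rule integrable.intros[OF gaussian_moment_0])
  have int: "integrable lborel (\<lambda>x. indicator {..y} x *\<^sub>R ?f x)" for y
    by (rule integrable_mult_indicator[OF _ f]) simp
  have "gauss_primitive b - gauss_primitive a
      = (\<integral>x. indicator {..b} x *\<^sub>R ?f x - indicator {..a} x *\<^sub>R ?f x \<partial>lborel)"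
    unfolding gauss_primitive_def using int by (intro Bochner_Integration.integral_diff[symmetric])
  also have "\<dots> \<le> (\<integral>x. indicator {a<..b} x *\<^sub>R exp (- a\<^sup>2) \<partial>lborel)"
  proof (rule integral_mono)
    show "integrable lborel (\<lambda>x. indicator {..b} x *\<^sub>R ?f x - indicator {..a} x *\<^sub>R ?f x)"
      using int by (intro Bochner_Integration.integrable_diff)
    show "integrable lborel (\<lambda>x. indicator {a<..b} x *\<^sub>R exp (- a\<^sup>2))"
      using assms by (intro integrable_scaleR_left) (auto intro!: integrable_real_indicator)
    show "indicator {..b} x *\<^sub>R ?f x - indicator {..a} x *\<^sub>R ?f x \<le> indicator {a<..b} x *\<^sub>R exp (- a\<^sup>2)"
      for x
      using assms by (auto simp: indicator_def intro: power_mono)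
  qed
  also have "\<dots> = (b - a) * exp (- a\<^sup>2)"
    using assms by simp
  finally show ?thesis .
qed

lemma gauss_primitive_le:
  assumes "0 \<le> a"
  shows "gauss_primitive a \<le> a"
proof -
  have "gauss_primitive 0 = integral\<^sup>L lborel (\<lambda>x::real. 0 :: real)"
    unfolding gauss_primitive_def
    by (rule integral_cong_AE) (auto intro!: AE_I[where N="{0}"] simp: indicator_def)
  then show ?thesis
    using gauss_primitive_diff_le[of 0 a] assms by simp
qed

text \<open>A left-endpoint Riemann sum of mesh 2 \<mu> on the grid \<mu>, 3 \<mu>, 5 \<mu>, ... for
  a decreasing function; the omitted interval from 0 to \<mu> costs at most \<mu>.\<close>

lemma sum_exp_ge_gauss_primitive:
  assumes "\<mu> \<ge> 0"
  shows "2 * \<mu> * (\<Sum>r<R. exp (- (\<mu> * (2 * real r + 1))\<^sup>2)) \<ge> gauss_primitive (\<mu> * (2 * real R + 1)) - \<mu>"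
proof (induction R)
  case 0
  then show ?case using gauss_primitive_le[OF assms] by simp
next
  case (Suc R)
  have "gauss_primitive (\<mu> * (2 * real (Suc R) + 1)) - gauss_primitive (\<mu> * (2 * real R + 1))
      \<le> (\<mu> * (2 * real (Suc R) + 1) - \<mu> * (2 * real R + 1)) * exp (- (\<mu> * (2 * real R + 1))\<^sup>2)"
    using assms by (intro gauss_primitive_diff_le mult_left_mono) auto
  then show ?case using Suc by (simp add: algebra_simps)
qed

text \<open>Each odd difference \<open>2 r + 1\<close> with \<open>r < R\<close> is attained, up to sign, by at least
  \<open>2 (n - 2 R)\<close> pairs.\<close>

lemma sum_odd_pairs_ge:
  fixes h :: "real \<Rightarrow> real"
  assumes "\<And>x. h x \<ge> 0" "\<And>x. h (- x) = h x" "2 * R \<le> n"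
  shows "(\<Sum>(i, j)\<in>odd_pairs n. h (real i - real j)) \<ge> 2 * (real n - 2 * real R) * (\<Sum>r<R. h (2 * real r + 1))"
proof -
  let ?B = "{..<R} \<times> {..<n - 2 * R}"
  \<comment> \<open>\<open>up\<close> and \<open>dn\<close> realise the difference with its two
    signs, hence have disjoint images; \<open>j < n - 2 * R\<close> keeps the larger index below
    \<open>n\<close>.\<close>
  define up where "up = (\<lambda>(r, j). (j + 2 * r + 1, j :: nat))"
  define dn where "dn = (\<lambda>(r, j). (j :: nat, j + 2 * r + 1))"
  let ?H = "\<lambda>(i, j). h (real i - real j)"
  have "(\<Sum>z\<in>up ` ?B. ?H z) = (\<Sum>(r, j)\<in>?B. h (2 * real r + 1))"
    by (subst sum.reindex) (auto simp: up_def inj_on_def case_prod_beta add.commute)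
  moreover have "(\<Sum>z\<in>dn ` ?B. ?H z) = (\<Sum>(r, j)\<in>?B. h (- (2 * real r + 1)))"
    by (subst sum.reindex) (auto simp: dn_def inj_on_def case_prod_beta add.commute)
  then have "(\<Sum>z\<in>dn ` ?B. ?H z) = (\<Sum>(r, j)\<in>?B. h (2 * real r + 1))"
    unfolding assms(2) .
  moreover have "(\<Sum>(r, j)\<in>?B. h (2 * real r + 1)) = (real n - 2 * real R) * (\<Sum>r<R. h (2 * real r + 1))"
    using assms(3) by (simp add: sum.cartesian_product[symmetric] sum_distrib_left of_nat_diff)
  moreover have "(\<Sum>z\<in>up ` ?B \<union> dn ` ?B. ?H z) = (\<Sum>z\<in>up ` ?B. ?H z) + (\<Sum>z\<in>dn ` ?B. ?H z)"
    by (intro sum.union_disjoint) (auto simp: up_def dn_def)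
  moreover have "(\<Sum>z\<in>up ` ?B \<union> dn ` ?B. ?H z) \<le> (\<Sum>z\<in>odd_pairs n. ?H z)"
  proof (rule sum_mono2)
    show "up ` ?B \<union> dn ` ?B \<subseteq> odd_pairs n"
      by (auto simp: up_def dn_def odd_pairs_def)
  qed (use assms(1) in auto)
  ultimately show ?thesis
    using assms(2) by (simp add: algebra_simps)
qed

text \<open>With \<mu> = 1 / N the choice of \<epsilon> turns the weights into exp (- (\<mu> k)^2).
  Taking R = N^2 differences makes the mesh 2 / N small and the range 2 N + 1 / N large, while n =
  N^3 keeps the loss (n - 2 R) / n = 1 - 2 / N close to 1.\<close>

lemma fejer_weight_ge:
  assumes "N \<ge> 2"
  shows "fejer_weight (N ^ 3) (sqrt 2 / real N)
    \<ge> 2 * sqrt 2 / pi * ((1 - 2 / real N) * (gauss_primitive (2 * real N + 1 / real N) - 1 / real N))"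
proof -
  define \<mu> where "\<mu> = 1 / real N"
  let ?n = "N ^ 3" and ?R = "N\<^sup>2"
  let ?h = "\<lambda>x. exp (- (\<mu> * x)\<^sup>2)"
  let ?S = "\<Sum>r<?R. ?h (2 * real r + 1)"
  have weight: "fejer_weight ?n (sqrt 2 / real N)
      = 2 * sqrt 2 / pi * (\<mu> / real ?n * (\<Sum>(i, j)\<in>odd_pairs ?n. ?h (real i - real j)))"
    by (simp add: fejer_weight_def \<mu>_def power_mult_distrib power_divide)
  have 1: "\<mu> / real ?n * (\<Sum>(i, j)\<in>odd_pairs ?n. ?h (real i - real j))
      \<ge> \<mu> / real ?n * (2 * (real ?n - 2 * real ?R) * ?S)"
    using assms by (intro mult_left_mono sum_odd_pairs_ge) (auto simp: \<mu>_def power3_eq_cube power2_eq_square)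
  have 2: "\<mu> / real ?n * (2 * (real ?n - 2 * real ?R) * ?S) = (1 - 2 / real N) * (2 * \<mu> * ?S)"
    using assms by (simp add: field_simps power3_eq_cube power2_eq_square)
  have 3: "(1 - 2 / real N) * (2 * \<mu> * ?S) \<ge> (1 - 2 / real N) * (gauss_primitive (\<mu> * (2 * real ?R + 1)) - \<mu>)"
    using assms by (intro mult_left_mono sum_exp_ge_gauss_primitive) (auto simp: \<mu>_def)
  have 4: "\<mu> * (2 * real ?R + 1) = 2 * real N + \<mu>"
    using assms by (simp add: \<mu>_def field_simps power2_eq_square)
  have "(1 - 2 / real N) * (gauss_primitive (2 * real N + \<mu>) - \<mu>)
      \<le> \<mu> / real ?n * (\<Sum>(i, j)\<in>odd_pairs ?n. ?h (real i - real j))"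
    using order.trans[OF 3[unfolded 4] 1[unfolded 2]] .
  then show ?thesis
    unfolding weight \<mu>_def[symmetric] by (intro mult_left_mono) simp_all
qed

text \<open>The lower bound \<open>B N\<close> on the weights tends to (2 sqrt 2 / pi) (sqrt pi / 2)
  = sqrt (2 / pi).\<close>

lemma le_of_le_fejer_weight:
  assumes le: "\<And>n \<epsilon>. n > 0 \<Longrightarrow> c * (fejer_weight n \<epsilon>)\<^sup>2 \<le> b" and c: "c \<ge> 0"
  shows "c * (2 / pi) \<le> b"
proof -
  define B where "B N = 2 * sqrt 2 / pi *
    ((1 - 2 / real N) * (gauss_primitive (2 * real N + 1 / real N) - 1 / real N))" for N
  have inv: "(\<lambda>N. 1 / real N) \<longlonglongrightarrow> 0"
    by (rule lim_1_over_n)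
  have top: "filterlim (\<lambda>N. 2 * real N + 1 / real N) at_top sequentially"
    by real_asymp
  have "B \<longlonglongrightarrow> 2 * sqrt 2 / pi * ((1 - 2 * 0) * (sqrt pi / 2 - 0))"
    unfolding B_def using inv tendsto_mult_left[OF inv, of 2]
    by (intro tendsto_intros filterlim_compose[OF gauss_primitive_tendsto top]) simp_all
  also have "2 * sqrt 2 / pi * ((1 - 2 * 0) * (sqrt pi / 2 - 0)) = sqrt 2 * (sqrt pi / pi)"
    by simp
  also have "sqrt pi / pi = 1 / sqrt pi"
    by (subst sqrt_divide_self_eq) (simp_all add: inverse_eq_divide)
  finally have B: "B \<longlonglongrightarrow> sqrt 2 / sqrt pi"
    by simp
  have "(\<lambda>N. c * (B N)\<^sup>2) \<longlonglongrightarrow> c * (sqrt 2 / sqrt pi)\<^sup>2"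
    by (intro tendsto_intros B)
  then have "(\<lambda>N. c * (B N)\<^sup>2) \<longlonglongrightarrow> c * (2 / pi)"
    by (simp add: power_divide)
  moreover have "\<forall>\<^sub>F N in sequentially. c * (B N)\<^sup>2 \<le> b"
  proof -
    \<comment> \<open>Positivity allows the lower bound on the weight to be squared.\<close>
    have "\<forall>\<^sub>F N in sequentially. B N > 0"
      using order_tendstoD(1)[OF B, of 0] by simp
    then show ?thesis
      using eventually_ge_at_top[of 2]
    proof eventually_elim
      case (elim N)
      have "c * (B N)\<^sup>2 \<le> c * (fejer_weight (N ^ 3) (sqrt 2 / real N))\<^sup>2"
        using elim fejer_weight_ge[of N] c by (intro mult_left_mono power_mono) (auto simp: B_def)
      also have "\<dots> \<le> b"
        using elim by (intro le) simp
      finally show ?case .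
    qed
  qed
  ultimately show ?thesis
    by (intro tendsto_upperbound[of _ _ sequentially]) auto
qed

section \<open>From bounded values to cuts\<close>

text \<open>The sum is affine in the value at \<open>v\<close>, so one endpoint of [-1, 1] does not
  increase it.\<close>

lemma round_vertex:
  fixes a :: "'a \<Rightarrow> real"
  assumes "finite E" "\<And>e. e \<in> E \<Longrightarrow> finite e" "\<bar>a v\<bar> \<le> 1"
  shows "\<exists>\<tau>\<in>{-1, 1}. (\<Sum>e\<in>E. prod (a(v := \<tau>)) e) \<le> (\<Sum>e\<in>E. prod a e)"
proof -
  define Q where "Q = (\<Sum>e\<in>{e\<in>E. v \<in> e}. prod a (e - {v}))"
  define P where "P = (\<Sum>e\<in>{e\<in>E. v \<notin> e}. prod a e)"
  have affine: "(\<Sum>e\<in>E. prod (a(v := \<tau>)) e) = P + \<tau> * Q" for \<tau>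
  proof -
    have "(\<Sum>e\<in>E. prod (a(v := \<tau>)) e)
        = (\<Sum>e\<in>{e\<in>E. v \<notin> e}. prod (a(v := \<tau>)) e) + (\<Sum>e\<in>{e\<in>E. v \<in> e}. prod (a(v := \<tau>)) e)"
      using assms(1) by (subst sum.union_disjoint[symmetric]) (auto intro: sum.cong)
    also have "(\<Sum>e\<in>{e\<in>E. v \<notin> e}. prod (a(v := \<tau>)) e) = P"
      unfolding P_def by (intro sum.cong prod.cong) auto
    also have "(\<Sum>e\<in>{e\<in>E. v \<in> e}. prod (a(v := \<tau>)) e) = \<tau> * Q"
      unfolding Q_def sum_distrib_left
    proof (rule sum.cong[OF refl])
      fix e assume "e \<in> {e\<in>E. v \<in> e}"
      then show "prod (a(v := \<tau>)) e = \<tau> * prod a (e - {v})"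
        using assms(2) by (subst prod.remove[of _ v]) (auto intro!: prod.cong)
    qed
    finally show ?thesis .
  qed
  have "min (- Q) Q \<le> a v * Q"
  proof -
    have "\<bar>a v * Q\<bar> \<le> \<bar>Q\<bar>"
      using mult_right_mono[OF assms(3), of "\<bar>Q\<bar>"] by (simp add: abs_mult)
    then show ?thesis by linarith
  qed
  moreover have "(\<Sum>e\<in>E. prod a e) = P + a v * Q"
    using affine[of "a v"] by simp
  ultimately show ?thesis
    using affine[of 1] affine[of "-1"] by (auto simp: min_def split: if_splits)
qed

text \<open>Round one vertex at a time; the bound on all values is carried along for the vertices
  still to be rounded.\<close>

lemma round_to_signs:
  fixes a :: "'a \<Rightarrow> real"
  assumes "finite S" "finite E" "\<And>e. e \<in> E \<Longrightarrow> finite e" "\<And>v. \<bar>a v\<bar> \<le> 1"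
  shows "\<exists>s. (\<forall>v\<in>S. s v \<in> {-1, 1}) \<and> (\<forall>v. \<bar>s v\<bar> \<le> 1) \<and> (\<Sum>e\<in>E. prod s e) \<le> (\<Sum>e\<in>E. prod a e)"
  using assms(1)
proof (induction S rule: finite_induct)
  case empty
  then show ?case using assms(4) by auto
next
  case (insert v S)
  then obtain s where s: "\<forall>v\<in>S. s v \<in> {-1, 1}" "\<forall>v. \<bar>s v\<bar> \<le> 1"
    "(\<Sum>e\<in>E. prod s e) \<le> (\<Sum>e\<in>E. prod a e)"
    by blast
  obtain \<tau> where \<tau>: "\<tau> \<in> {-1, 1}" "(\<Sum>e\<in>E. prod (s(v := \<tau>)) e) \<le> (\<Sum>e\<in>E. prod s e)"
    using round_vertex[OF assms(2,3), of s v] s(2) by blast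
  show ?case
    using s \<tau> by (intro exI[of _ "s(v := \<tau>)"]) auto
qed

text \<open>An edge has product -1 exactly when its ends carry opposite signs, so these edges join
  the two sign classes.\<close>

lemma card_cut_le_mc:
  fixes s :: "'a \<Rightarrow> real"
  assumes G: "finite_simple_graph G" and s: "\<And>v. v \<in> verts G \<Longrightarrow> s v \<in> {-1, 1}"
  shows "card {e \<in> edges G. prod s e = - 1} \<le> mc G"
proof -
  let ?C = "{e \<in> edges G. prod s e = - 1}"
  let ?M = "{card (edges H) | H. is_subgraph H G \<and> bipartite H}"
  have fin: "finite (edges G)"
    using G by (auto simp: finite_simple_graph_def intro: finite_subset[of _ "Pow (verts G)"])
  have "bipartite (verts G, ?C)"
    unfolding bipartite_def
  proof (intro exI conjI ballI)
    let ?A = "{v \<in> verts G. s v = 1}" and ?B = "{v \<in> verts G. s v = - 1}"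
    show "?A \<union> ?B = verts (verts G, ?C)" "?A \<inter> ?B = {}"
      using s by auto
    fix e assume "e \<in> edges (verts G, ?C)"
    then have e: "e \<in> edges G" "prod s e = - 1" by auto
    then obtain u v where uv: "e = {u, v}" "u \<noteq> v"
      using G by (auto simp: finite_simple_graph_def card_2_iff)
    then have V: "u \<in> verts G" "v \<in> verts G"
      using G e by (auto simp: finite_simple_graph_def)
    have "s u * s v = - 1"
      using e uv by simp
    then have "s u = 1 \<and> s v = - 1 \<or> s u = - 1 \<and> s v = 1"
      using s[OF V(1)] s[OF V(2)] by auto
    then show "\<exists>a\<in>?A. \<exists>b\<in>?B. e = {a, b}"
      using V uv by auto
  qed
  moreover have "is_subgraph (verts G, ?C) G"
    using G by (auto simp: is_subgraph_def finite_simple_graph_def)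
  ultimately have "card ?C \<in> ?M"
    by force
  moreover have "finite ?M"
    by (rule finite_subset[of _ "{..card (edges G)}"]) (auto simp: is_subgraph_def intro: card_mono fin)
  ultimately show ?thesis
    unfolding mc_def by (rule Max_ge[rotated])
qed

text \<open>Edge products are 1 or -1, so their sum is the number of edges minus twice the size of
  the cut.\<close>

lemma sp_ge_of_signs:
  fixes s :: "'a \<Rightarrow> real"
  assumes G: "finite_simple_graph G" and s: "\<And>v. v \<in> verts G \<Longrightarrow> s v \<in> {-1, 1}"
  shows "sp G \<ge> - (\<Sum>e\<in>edges G. prod s e) / 2"
proof -
  let ?C = "{e \<in> edges G. prod s e = - 1}"
  have fin: "finite (edges G)"
    using G by (auto simp: finite_simple_graph_def intro: finite_subset[of _ "Pow (verts G)"])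
  have pm: "prod s e \<in> {-1, 1}" if "e \<in> edges G" for e
  proof -
    have e: "e \<subseteq> verts G" "finite e"
      using G that by (auto simp: finite_simple_graph_def intro: finite_subset)
    from e(2,1) show ?thesis
    proof (induction e rule: finite_induct)
      case (insert v e)
      then show ?case using s[of v] by auto
    qed simp
  qed
  have "(\<Sum>e\<in>edges G. prod s e) = (\<Sum>e\<in>edges G. 1 - 2 * (if prod s e = - 1 then 1 else 0))"
    using pm by (intro sum.cong) auto
  also have "\<dots> = real (card (edges G)) - 2 * real (card ?C)"
    using fin by (simp add: sum_subtractf sum_distrib_left[symmetric] sum.If_cases Int_def)
  finally show ?thesis
    using card_cut_le_mc[OF assms] by (simp add: sp_def)
qed

section \<open>Averaging the roundings and conclusion\<close>

lemma sp_ge_fejer_weight: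
  assumes G: "finite_simple_graph G" and n: "n > 0" and t: "t \<ge> 0"
    and unit: "\<And>v. v \<in> verts G \<Longrightarrow> euclid_inner d (x v) (x v) = 1"
    and edge: "\<And>u v. u \<in> verts G \<Longrightarrow> v \<in> verts G \<Longrightarrow> u \<noteq> v \<Longrightarrow> {u, v} \<in> edges G \<Longrightarrow>
      euclid_inner d (x u) (x v) = - t"
  shows "real (card (edges G)) * t / 2 * (fejer_weight n \<epsilon>)\<^sup>2 \<le> sp G"
proof -
  interpret prob_space "gauss d" by (rule prob_space_gauss)
  let ?E = "edges G"
  define a where "a g v = fejer n (\<epsilon> * euclid_inner d g (x v))" for g v
  have a1: "\<bar>a g v\<bar> \<le> 1" for g v
    unfolding a_def using n by (rule abs_fejer_le_1)
  have fin: "finite ?E"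
    using G by (auto simp: finite_simple_graph_def intro: finite_subset[of _ "Pow (verts G)"])
  have fine: "finite e" if "e \<in> ?E" for e
    using G that by (auto simp: finite_simple_graph_def intro: finite_subset)
  have meas [measurable]: "(\<lambda>g. a g v) \<in> borel_measurable (gauss d)" for v
    unfolding a_def by measurable
  have int: "integrable (gauss d) (\<lambda>g. prod (a g) e)" for e
  proof (rule integrable_gauss_bounded)
    show "norm (prod (a g) e) \<le> 1" for g
      using a1 by (auto simp: abs_prod intro!: prod_le_1)
  qed measurable
  \<comment> \<open>The signs may depend on \<open>g\<close> in any way: they do not occur in this
    bound, so only \<open>a\<close> has to be integrated.\<close>
  have *: "- 2 * sp G \<le> (\<Sum>e\<in>?E. prod (a g) e)" for g
  proof -
    obtain s where "\<forall>v\<in>verts G. s v \<in> {-1, 1}" "(\<Sum>e\<in>?E. prod s e) \<le> (\<Sum>e\<in>?E. prod (a g) e)"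
      using round_to_signs[of "verts G" ?E "a g"] G fin fine a1 by (auto simp: finite_simple_graph_def)
    then show ?thesis
      using sp_ge_of_signs[OF G, of s] by auto
  qed
  have "- 2 * sp G \<le> (\<integral>g. (\<Sum>e\<in>?E. prod (a g) e) \<partial>gauss d)"
    using * int by (intro integral_ge_const) auto
  also have "\<dots> = (\<Sum>e\<in>?E. \<integral>g. prod (a g) e \<partial>gauss d)"
    using int by simp
  also have "\<dots> \<le> (\<Sum>e\<in>?E. - t * (fejer_weight n \<epsilon>)\<^sup>2)"
  proof (rule sum_mono)
    fix e assume e: "e \<in> ?E"
    then obtain u v where uv: "e = {u, v}" "u \<noteq> v"
      using G by (auto simp: finite_simple_graph_def card_2_iff)
    then have V: "u \<in> verts G" "v \<in> verts G"
      using G e by (auto simp: finite_simple_graph_def)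
    show "(\<integral>g. prod (a g) e \<partial>gauss d) \<le> - t * (fejer_weight n \<epsilon>)\<^sup>2"
      using gauss_fejer_fejer_le[OF unit[OF V(1)] unit[OF V(2)], of n \<epsilon>] edge[OF V uv(2)] e uv t
      by (simp add: a_def)
  qed
  finally show ?thesis by simp
qed

theorem theorem1p5:
  fixes G :: "'a ugraph" and m :: nat and \<theta> :: real
  assumes "finite_simple_graph G"
    and "m = card (edges G)"
    and "\<theta> = lovasz_theta (complement_graph G)"
  shows "sp G \<ge> 1 / pi * (real m / (\<theta> - 1))"
proof -
  let ?F = "complement_graph G"
  have "theta_feasible ?F \<theta>"
    unfolding assms(3)
    by (rule theta_feasible_lovasz_theta) (use assms(1) in \<open>simp add: complement_graph_def finite_simple_graph_def\<close>)
  then obtain d and x :: "'a \<Rightarrow> nat \<Rightarrow> real" where \<theta>: "\<theta> \<ge> 2"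
    and unit: "\<forall>v\<in>verts ?F. euclid_inner d (x v) (x v) = 1"
    and nonadj: "\<forall>u\<in>verts ?F. \<forall>v\<in>verts ?F. u \<noteq> v \<longrightarrow> {u, v} \<notin> edges ?F \<longrightarrow>
      euclid_inner d (x u) (x v) = - (1 / (\<theta> - 1))"
    unfolding theta_feasible_def by auto
  define t where "t = 1 / (\<theta> - 1)"
  have t: "t \<ge> 0"
    using \<theta> by (simp add: t_def)
  have unit': "euclid_inner d (x v) (x v) = 1" if "v \<in> verts G" for v
    using unit that by (simp add: complement_graph_def)
  \<comment> \<open>An edge of \<open>G\<close> is a non-edge of the complement, where the inner
    product is prescribed.\<close>
  have edge: "euclid_inner d (x u) (x v) = - t"
    if "u \<in> verts G" "v \<in> verts G" "u \<noteq> v" "{u, v} \<in> edges G" for u v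
    unfolding t_def using that
    by (intro nonadj[rule_format]) (auto simp: complement_graph_def doubleton_eq_iff insert_commute)
  have "real m * t / 2 * (fejer_weight n \<epsilon>)\<^sup>2 \<le> sp G" if "n > 0" for n \<epsilon>
    unfolding assms(2) by (rule sp_ge_fejer_weight[OF assms(1) that t unit' edge])
  \<comment> \<open>As \<open>n\<close> and \<open>\<epsilon>\<close> are arbitrary, the squared
    weight may be replaced by its limiting value 2 / pi.\<close>
  then have "real m * t / 2 * (2 / pi) \<le> sp G"
    by (rule le_of_le_fejer_weight) (use t in simp_all)
  moreover have "real m * t / 2 * (2 / pi) = 1 / pi * (real m * t)"
    by simp
  moreover have "real m * t = real m / (\<theta> - 1)"
    by (simp add: t_def)
  ultimately show ?thesis
    by (simp only:)
qed

end
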